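(* Let $G=(V,E)$ be a finite simple undirected graph and let $A\subseteq V$. (1) If $A$ is a local set of $G$, then for all $a\in A$, $\mathrm{cutrk}(A)\le \mathrm{cutrk}(A\setminus\{a\})$. (2) $A$ is a minimal local set of $G$ if and only if $A$ is not full cut-rank but each proper subset of $A$ is full cut-rank; equivalently, $A\neq\emptyset$ and for all $a\in A$, $\mathrm{cutrk}(A)\le \mathrm{cutrk}(A\setminus\{a\})=|A|-1$.
   Context: For a finite simple undirected graph $G=(V,E)$ and $D\subseteq V$, the odd neighborhood of $D$ is $Odd_G(D)=\{v\in V : |N_G(v)\cap D| \equiv 1 \pmod 2\}$, where $N_G(v)$ is the set of neighbors of $v$. A local set of $G$ is a non-empty subset $L\subseteq V$ of the form $L=D\cup Odd_G(D)$ for some $D\subseteq V$. A minimal local set is a local set that is minimal by inclusion among local sets. The cut-rank function $\mathrm{cutrk}:2^V\to\mathbb N$ of $G$ maps $A\subseteq V$ to the rank over $\mathbb F_2$ of the matrix $\Gamma_A$ with rows indexed by $A$, columns indexed by $V\setminus A$, and entry $1$ at $(a,b)$ if $(a,b)\in E$ and $0$ otherwise (the rank of an empty matrix is $0$). A set $A\subseteq V$ is full cut-rank if $\mathrm{cutrk}(A)=|A|$. *)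

theory Defs
  imports
    "Graph_Theory.Pair_Digraph"
    "Jordan_Normal_Form.DL_Rank"
    "HOL-Library.Z2"
    "HOL-Library.Countable_Set"
begin

text \<open>
  A finite simple undirected graph is a \<^locale>\<open>pair_graph\<close>: \<^term>\<open>parcs G\<close> is an irreflexive,
  symmetric relation on the finite set \<^term>\<open>pverts G\<close>, so \<open>{u, v}\<close> is an edge iff
  \<open>(u, v) \<in> parcs G\<close>.
\<close>

definition neighbors :: "'a pair_pre_digraph \<Rightarrow> 'a \<Rightarrow> 'a set" where
  "neighbors G v = {u \<in> pverts G. (v, u) \<in> parcs G}"

definition odd_nbhd :: "'a pair_pre_digraph \<Rightarrow> 'a set \<Rightarrow> 'a set" where
  "odd_nbhd G D = {v \<in> pverts G. odd (card (neighbors G v \<inter> D))}"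

definition local_set :: "'a pair_pre_digraph \<Rightarrow> 'a set \<Rightarrow> bool" where
  "local_set G L \<longleftrightarrow> L \<noteq> {} \<and> (\<exists>D \<subseteq> pverts G. L = D \<union> odd_nbhd G D)"

definition minimal_local_set :: "'a pair_pre_digraph \<Rightarrow> 'a set \<Rightarrow> bool" where
  "minimal_local_set G L \<longleftrightarrow> local_set G L \<and> (\<forall>M. local_set G M \<and> M \<subseteq> L \<longrightarrow> M = L)"

text \<open>
  Matrices are indexed by initial segments of the naturals, so rows and columns are listed using
  the bijections \<^term>\<open>from_nat_into S\<close> from \<open>{..<card S}\<close> to a finite set \<open>S\<close>; the rank does not
  depend on this choice. The field with two elements is the type \<^typ>\<open>bit\<close>.
\<close>

definition cut_mat :: "'a pair_pre_digraph \<Rightarrow> 'a set \<Rightarrow> bit mat" where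
  "cut_mat G A = mat (card A) (card (pverts G - A))
     (\<lambda>(i, j). if (from_nat_into A i, from_nat_into (pverts G - A) j) \<in> parcs G then 1 else 0)"

text \<open>The parameter of \<^const>\<open>vec_space.rank\<close> is the number of rows.\<close>

definition cutrk :: "'a pair_pre_digraph \<Rightarrow> 'a set \<Rightarrow> nat" where
  "cutrk G A = vec_space.rank (card A) (cut_mat G A)"

definition full_cutrk :: "'a pair_pre_digraph \<Rightarrow> 'a set \<Rightarrow> bool" where
  "full_cutrk G A \<longleftrightarrow> cutrk G A = card A"

end

theory Submission
  imports Defs
begin

text \<open>
  The sets \<open>D \<subseteq> A\<close> with \<open>Odd(D) \<subseteq> A\<close> form the left kernel of the cut matrix, which therefore has
  \<open>2 ^ (card A - cutrk A)\<close> elements, and \<open>A\<close> contains a local set iff this kernel is nontrivial. If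
  \<open>A = D \<union> Odd(D)\<close>, then \<open>D\<close> is in the kernel for \<open>A\<close> but not in the kernel for \<open>A - {a}\<close>, so
  removing \<open>a\<close> makes the kernel strictly smaller. The size of the kernel is computed with characters
  of the two-element field rather than by comparing row rank and column rank.
\<close>

text \<open>These rules turn field arithmetic on \<^typ>\<open>bit\<close> into bit operations, hiding the ring structure.\<close>

declare add_bit_eq_xor [simp del] mult_bit_eq_and [simp del]

section \<open>Cardinalities of vector spaces over the two-element field\<close>

text \<open>Coordinates in a finite basis put the vectors in bijection with functions from the basis
  to the field. Taking these functions extensional makes them unique, so that
  \<open>card_PiE\<close> counts them.\<close>

lemma (in vectorspace) card_carrier_eq_power_dim:
  assumes fin_dim
  shows "card (carrier V) = card (carrier K) ^ dim"
proof -
  obtain \<beta> where \<beta>: "finite \<beta>" "basis \<beta>"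
    using finite_basis_exists[OF assms] by blast
  then have sub: "\<beta> \<subseteq> carrier V"
    unfolding basis_def by blast
  have unique: "\<exists>!a. a \<in> \<beta> \<rightarrow>\<^sub>E carrier K \<and> lincomb a \<beta> = v" if "v \<in> carrier V" for v
    using basis_criterion[OF \<beta>(1) sub] \<beta>(2) that by blast
  have closed: "lincomb a \<beta> \<in> carrier V" if "a \<in> \<beta> \<rightarrow>\<^sub>E carrier K" for a
    using that sub by (intro lincomb_closed) auto
  have "bij_betw (\<lambda>a. lincomb a \<beta>) (\<beta> \<rightarrow>\<^sub>E carrier K) (carrier V)"
    unfolding bij_betw_def
  proof
    show "inj_on (\<lambda>a. lincomb a \<beta>) (\<beta> \<rightarrow>\<^sub>E carrier K)"
      using unique closed by (intro inj_onI) metis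
    show "(\<lambda>a. lincomb a \<beta>) ` (\<beta> \<rightarrow>\<^sub>E carrier K) = carrier V"
      using unique closed by blast
  qed
  then have "card (carrier V) = card (\<beta> \<rightarrow>\<^sub>E carrier K)"
    using bij_betw_same_card by metis
  then show ?thesis
    using \<beta> by (simp add: card_PiE dim_basis)
qed

lemma card_UNIV_bit: "card (UNIV :: bit set) = 2"
proof -
  have "(UNIV :: bit set) = {0, 1}"
    by (auto intro: bit.exhaust)
  then show ?thesis
    by (metis card_2_iff zero_neq_one)
qed

lemma of_nat_bit_eq_0_iff: "(of_nat k :: bit) = 0 \<longleftrightarrow> even k"
proof -
  have "(b :: bit) = 0 \<longleftrightarrow> even b" for b
    by (cases b) auto
  then show ?thesis
    by (metis even_of_nat)
qed

lemma card_carrier_vec_bit: "card (carrier_vec n :: bit vec set) = 2 ^ n"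
proof -
  interpret vec_space "TYPE(bit)" n .
  show ?thesis
    using card_carrier_eq_power_dim[OF fin_dim] dim_is_n by (simp add: card_UNIV_bit)
qed

lemma finite_carrier_vec_bit: "finite (carrier_vec n :: bit vec set)"
  using card_carrier_vec_bit[of n] by (intro card_ge_0_finite) simp

text \<open>The rank is by definition the dimension of the column span; this turns it into a
  count.\<close>

lemma card_span_cols_bit:
  fixes M :: "bit mat"
  assumes "M \<in> carrier_mat n nc"
  shows "card (LinearCombinations.module.span class_ring (module_vec TYPE(bit) n) (set (cols M)))
    = 2 ^ vec_space.rank n M"
proof -
  interpret vec_space "TYPE(bit)" n .
  have sub: "set (cols M) \<subseteq> carrier_vec n"
    using assms cols_dim by blast
  interpret S: vectorspace class_ring "span_vs (set (cols M))"
    using span_is_subspace[of "set (cols M)"] sub subspace_is_vs by simp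
  show ?thesis
    using S.card_carrier_eq_power_dim fin_dim_span_cols[OF assms]
    by (simp add: rank_def card_UNIV_bit)
qed

section \<open>Character sums and orthogonal complements\<close>

text \<open>The nontrivial additive character of the two-element field. Its values are integers
  because an integer sum equal to its own negative vanishes, which fails in
  \<open>bit\<close>.\<close>

definition bit_char :: "bit \<Rightarrow> int" where
  "bit_char b = (if b = 0 then 1 else -1)"

lemma bit_char_add_1: "bit_char (b + 1) = - bit_char b"
  by (cases b) (auto simp: bit_char_def)

text \<open>If some \<open>d\<close> in \<open>C\<close> has scalar product 1 with \<open>u\<close>,
  translation by \<open>d\<close> permutes \<open>C\<close> and flips every sign, so the sum is its
  own negative. Otherwise every term is 1.\<close>

lemma sum_bit_char:
  fixes u :: "bit vec"
  assumes C: "C \<subseteq> carrier_vec n" and add: "\<And>c d. c \<in> C \<Longrightarrow> d \<in> C \<Longrightarrow> c + d \<in> C"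
    and u: "u \<in> carrier_vec n"
  shows "(\<Sum>c\<in>C. bit_char (u \<bullet> c)) = (if \<forall>c\<in>C. u \<bullet> c = 0 then int (card C) else 0)"
proof (cases "\<forall>c\<in>C. u \<bullet> c = 0")
  case True
  then show ?thesis
    by (simp add: bit_char_def)
next
  case False
  then obtain d where d: "d \<in> C" "u \<bullet> d = 1"
    by (metis bit_not_zero_iff)
  \<comment> \<open>In characteristic two, translation by \<open>d\<close> is its own
    inverse.\<close>
  have cancel: "c + d + d = c" if "c \<in> C" for c
  proof -
    have "d + d = 0\<^sub>v n"
      using d C by (intro eq_vecI) (auto simp flip: mult_2)
    then show ?thesis
      using that d C by (metis assoc_add_vec right_zero_vec subsetD)
  qed
  have bij: "bij_betw (\<lambda>c. c + d) C C"
    by (rule bij_betw_byWitness[where f' = "\<lambda>c. c + d"]) (use cancel add d in auto)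
  have "(\<Sum>c\<in>C. bit_char (u \<bullet> c)) = (\<Sum>c\<in>C. bit_char (u \<bullet> (c + d)))"
    using sum.reindex_bij_betw[OF bij, of "\<lambda>c. bit_char (u \<bullet> c)"] by simp
  also have "\<dots> = (\<Sum>c\<in>C. - bit_char (u \<bullet> c))"
  proof (rule sum.cong)
    fix c assume "c \<in> C"
    then have "u \<bullet> (c + d) = u \<bullet> c + 1"
      using d C u scalar_prod_add_distrib[of u n c d] by auto
    then show "bit_char (u \<bullet> (c + d)) = - bit_char (u \<bullet> c)"
      by (simp only: bit_char_add_1)
  qed simp
  finally show ?thesis
    unfolding if_not_P[OF False] by (simp add: sum_negf)
qed

lemma zero_vec_if_scalar_prod_zero:
  fixes c :: "'a :: comm_ring_1 vec"
  assumes c: "c \<in> carrier_vec n" and zero: "\<And>u. u \<in> carrier_vec n \<Longrightarrow> c \<bullet> u = 0"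
  shows "c = 0\<^sub>v n"
proof (rule eq_vecI)
  fix i assume i: "i < dim_vec (0\<^sub>v n :: 'a vec)"
  then have "c $ i = c \<bullet> unit_vec n i"
    using c by (simp add: scalar_prod_right_unit)
  then show "c $ i = 0\<^sub>v n $ i"
    using zero i by simp
qed (use c in simp)

text \<open>Both sides evaluate the sum of \<open>bit_char (u \<bullet> c)\<close> over all \<open>u\<close> and all \<open>c \<in> C\<close>.\<close>

lemma card_orthogonal_bit:
  fixes C :: "bit vec set"
  assumes C: "C \<subseteq> carrier_vec n" and zero: "0\<^sub>v n \<in> C"
    and add: "\<And>c d. c \<in> C \<Longrightarrow> d \<in> C \<Longrightarrow> c + d \<in> C"
  shows "card {u \<in> carrier_vec n. \<forall>c\<in>C. u \<bullet> c = 0} * card C = 2 ^ n"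
proof -
  let ?F = "carrier_vec n :: bit vec set"
  let ?S = "\<Sum>u\<in>?F. \<Sum>c\<in>C. bit_char (u \<bullet> c)"
  have finC: "finite C"
    using C finite_carrier_vec_bit finite_subset by blast
  have "?S = (\<Sum>u\<in>?F. if \<forall>c\<in>C. u \<bullet> c = 0 then int (card C) else 0)"
    using sum_bit_char[OF C add] by (intro sum.cong) auto
  also have "\<dots> = int (card {u \<in> ?F. \<forall>c\<in>C. u \<bullet> c = 0} * card C)"
    by (subst sum.inter_filter[symmetric]) (simp_all add: finite_carrier_vec_bit)
  finally have 1: "?S = int (card {u \<in> ?F. \<forall>c\<in>C. u \<bullet> c = 0} * card C)" .
  \<comment> \<open>After the swap the inner sum runs over the whole space, and only the zero vector
    is orthogonal to all of it, so a single \<open>c\<close> contributes.\<close>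
  have "?S = (\<Sum>c\<in>C. \<Sum>u\<in>?F. bit_char (c \<bullet> u))"
    using C by (subst sum.swap) (auto intro!: sum.cong simp: comm_scalar_prod[of _ n])
  also have "\<dots> = (\<Sum>c\<in>C. if c = 0\<^sub>v n then 2 ^ n else 0)"
  proof (rule sum.cong)
    fix c assume c: "c \<in> C"
    then have "(\<forall>u\<in>?F. c \<bullet> u = 0) \<longleftrightarrow> c = 0\<^sub>v n"
      using C zero_vec_if_scalar_prod_zero[of c n] by auto
    then show "(\<Sum>u\<in>?F. bit_char (c \<bullet> u)) = (if c = 0\<^sub>v n then 2 ^ n else 0)"
      using sum_bit_char[of ?F n c] c C by (auto simp: card_carrier_vec_bit)
  qed simp
  also have "\<dots> = 2 ^ n"
    using finC zero by (simp add: sum.delta)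
  finally have "int (card {u \<in> ?F. \<forall>c\<in>C. u \<bullet> c = 0} * card C) = int (2 ^ n)"
    unfolding 1 by simp
  then show ?thesis
    unfolding of_nat_eq_iff .
qed

text \<open>Rank-nullity in multiplicative form: a vector orthogonal to all columns is orthogonal to
  their span, so \<open>card_orthogonal_bit\<close> applies with the span as
  \<open>C\<close>.\<close>

lemma card_left_kernel_bit:
  fixes M :: "bit mat"
  assumes M: "M \<in> carrier_mat n nc"
  shows "card {u \<in> carrier_vec n. \<forall>j<nc. u \<bullet> col M j = 0} * 2 ^ vec_space.rank n M = 2 ^ n"
proof -
  interpret vec_space "TYPE(bit)" n .
  have sub: "set (cols M) \<subseteq> carrier_vec n"
    using M cols_dim by blast
  have "{u \<in> carrier_vec n. \<forall>j<nc. u \<bullet> col M j = 0} = orthogonal_complement (set (cols M))"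
    using M by (auto simp: orthogonal_complement_def cols_def)
  also have "\<dots> = {u \<in> carrier_vec n. \<forall>c\<in>span (set (cols M)). u \<bullet> c = 0}"
    using in_orthogonal_complement_span[OF sub] by (simp add: orthogonal_complement_def)
  finally have eq: "{u \<in> carrier_vec n. \<forall>j<nc. u \<bullet> col M j = 0} = \<dots>" .
  have "card {u \<in> carrier_vec n. \<forall>c\<in>span (set (cols M)). u \<bullet> c = 0} * card (span (set (cols M)))
      = 2 ^ n"
  proof (rule card_orthogonal_bit)
    show "span (set (cols M)) \<subseteq> carrier_vec n"
      using sub span_closed by auto
    show "0\<^sub>v n \<in> span (set (cols M))"
      using vectorspace.span_zero[OF vec_vs, of n "set (cols M)"] by (simp add: module_vec_simps)
    show "c + d \<in> span (set (cols M))" if "c \<in> span (set (cols M))" "d \<in> span (set (cols M))" for c d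
      using span_add1[of "set (cols M)" c d] sub that by simp
  qed
  then show ?thesis
    using eq card_span_cols_bit[OF M] by simp
qed

section \<open>Closed sets as the left kernel of the cut matrix\<close>

definition closed_sets :: "'a pair_pre_digraph \<Rightarrow> 'a set \<Rightarrow> 'a set set" where
  "closed_sets G A = {D. D \<subseteq> A \<and> odd_nbhd G D \<subseteq> A}"

lemma closed_sets_mono: "B \<subseteq> A \<Longrightarrow> closed_sets G B \<subseteq> closed_sets G A"
  by (auto simp: closed_sets_def)

lemma odd_nbhd_empty [simp]: "odd_nbhd G {} = {}"
  by (simp add: odd_nbhd_def)

lemma empty_in_closed_sets [simp]: "{} \<in> closed_sets G A"
  by (simp add: closed_sets_def)

lemma finite_closed_sets: "finite A \<Longrightarrow> finite (closed_sets G A)"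
  by (rule finite_subset[of _ "Pow A"]) (auto simp: closed_sets_def)

text \<open>Coordinates follow the enumeration \<open>from_nat_into A\<close> that also lists the
  rows of \<open>cut_mat G A\<close>, so that scalar products with its columns match up
  vertices.\<close>

definition indicator_vec :: "'a set \<Rightarrow> 'a set \<Rightarrow> bit vec" where
  "indicator_vec A D = vec (card A) (\<lambda>i. of_bool (from_nat_into A i \<in> D))"

lemma carrier_indicator_vec: "indicator_vec A D \<in> carrier_vec (card A)"
  by (simp add: indicator_vec_def)

lemma bij_betw_indicator_vec:
  assumes "finite A"
  shows "bij_betw (indicator_vec A) (Pow A) (carrier_vec (card A))"
proof -
  have bij: "bij_betw (from_nat_into A) {..<card A} A"
    by (rule bij_betw_from_nat_into_finite[OF assms])
  have "inj_on (indicator_vec A) (Pow A)"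
  proof (rule inj_onI)
    fix D E assume D: "D \<in> Pow A" and E: "E \<in> Pow A" and eq: "indicator_vec A D = indicator_vec A E"
    have "from_nat_into A i \<in> D \<longleftrightarrow> from_nat_into A i \<in> E" if "i < card A" for i
      using arg_cong[OF eq, of "\<lambda>v. v $ i"] that by (simp add: indicator_vec_def of_bool_def split: if_splits)
    then have "x \<in> D \<longleftrightarrow> x \<in> E" if "x \<in> A" for x
      using that bij by (metis bij_betw_imp_surj_on imageE lessThan_iff)
    then show "D = E"
      using D E by blast
  qed
  moreover have "u \<in> indicator_vec A ` Pow A" if u: "u \<in> carrier_vec (card A)" for u
  proof
    \<comment> \<open>The preimage of \<open>u\<close> is its support, read through the enumeration
      of \<open>A\<close>.\<close>
    let ?D = "from_nat_into A ` {i. i < card A \<and> u $ i = 1}"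
    show "?D \<in> Pow A"
      using bij by (auto simp: bij_betw_def)
    have "from_nat_into A i \<in> ?D \<longleftrightarrow> u $ i = 1" if "i < card A" for i
      using bij that by (auto simp: bij_betw_def inj_on_def)
    then show "u = indicator_vec A ?D"
      using u by (intro eq_vecI) (auto simp: indicator_vec_def of_bool_def)
  qed
  ultimately show ?thesis
    by (auto simp: bij_betw_def indicator_vec_def)
qed

context pair_graph
begin

text \<open>Column \<open>j\<close> marks the vertices of \<open>A\<close> adjacent to the
  \<open>j\<close>-th vertex outside \<open>A\<close>; the indicator keeps those in
  \<open>D\<close>, and summing in \<open>bit\<close> counts them modulo 2.\<close>

lemma indicator_vec_scalar_prod_col:
  assumes "A \<subseteq> pverts G" "D \<subseteq> A" "j < card (pverts G - A)"
  shows "indicator_vec A D \<bullet> col (cut_mat G A) j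
    = of_nat (card (neighbors G (from_nat_into (pverts G - A) j) \<inter> D))"
proof -
  let ?b = "from_nat_into (pverts G - A) j"
  have finA: "finite A"
    using assms(1) pair_finite_verts finite_subset by blast
  then have mem: "from_nat_into A i \<in> pverts G" if "i < card A" for i
    using bij_betw_from_nat_into_finite[of A] that assms(1) by (auto simp: bij_betw_def)
  \<comment> \<open>The matrix tests arcs into the outside vertex, whereas \<open>neighbors\<close>
    tests arcs out of it.\<close>
  have sym: "(a, b) \<in> parcs G \<longleftrightarrow> (b, a) \<in> parcs G" for a b
    using pair_sym_arcs by (auto simp: symmetric_def elim: symE)
  have "indicator_vec A D \<bullet> col (cut_mat G A) j
      = (\<Sum>i<card A. of_bool (from_nat_into A i \<in> neighbors G ?b \<inter> D))"
    using assms(3) mem sym unfolding scalar_prod_def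
    by (intro sum.cong)
      (auto simp: indicator_vec_def cut_mat_def neighbors_def simp del: sum_of_bool_eq)
  also have "\<dots> = (\<Sum>a\<in>A. of_bool (a \<in> neighbors G ?b \<inter> D))"
    by (rule sum.reindex_bij_betw[OF bij_betw_from_nat_into_finite[OF finA]])
  also have "\<dots> = of_nat (card (A \<inter> (neighbors G ?b \<inter> D)))"
    using finA by (simp add: of_bool_def Int_def flip: sum.inter_filter)
  also have "A \<inter> (neighbors G ?b \<inter> D) = neighbors G ?b \<inter> D"
    using assms(2) by blast
  finally show ?thesis .
qed

text \<open>The inclusion of \<open>odd_nbhd G D\<close> in \<open>A\<close> constrains only the
  vertices outside \<open>A\<close>, one for each column: even parity there is a vanishing scalar
  product. Indicator vectors thus identify closed sets with the left kernel.\<close>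

lemma card_closed_sets:
  assumes A: "A \<subseteq> pverts G"
  shows "card (closed_sets G A) * 2 ^ cutrk G A = 2 ^ card A"
proof -
  let ?K = "{u \<in> carrier_vec (card A). \<forall>j<card (pverts G - A). u \<bullet> col (cut_mat G A) j = 0}"
  have finA: "finite A"
    using A pair_finite_verts finite_subset by blast
  have bijB: "bij_betw (from_nat_into (pverts G - A)) {..<card (pverts G - A)} (pverts G - A)"
    using pair_finite_verts by (intro bij_betw_from_nat_into_finite) auto
  have iff: "D \<in> closed_sets G A \<longleftrightarrow> indicator_vec A D \<in> ?K" if D: "D \<in> Pow A" for D
  proof -
    have "D \<in> closed_sets G A \<longleftrightarrow> (\<forall>b\<in>pverts G - A. even (card (neighbors G b \<inter> D)))"
      using D by (auto simp: closed_sets_def odd_nbhd_def)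
    also have "\<dots> \<longleftrightarrow> (\<forall>j<card (pverts G - A).
        even (card (neighbors G (from_nat_into (pverts G - A) j) \<inter> D)))"
      using bij_betw_ball[OF bijB, of "\<lambda>b. even (card (neighbors G b \<inter> D))"]
      by (simp only: Ball_def lessThan_iff)
    also have "\<dots> \<longleftrightarrow> indicator_vec A D \<in> ?K"
      using D A indicator_vec_scalar_prod_col[of A D]
      by (auto simp: of_nat_bit_eq_0_iff carrier_indicator_vec)
    finally show ?thesis .
  qed
  note bij = bij_betw_indicator_vec[OF finA]
  have "indicator_vec A ` closed_sets G A = ?K"
  proof
    show "indicator_vec A ` closed_sets G A \<subseteq> ?K"
      using iff by (auto simp: closed_sets_def)
    show "?K \<subseteq> indicator_vec A ` closed_sets G A"
    proof
      fix u assume u: "u \<in> ?K"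
      then obtain D where "D \<in> Pow A" "u = indicator_vec A D"
        using bij unfolding bij_betw_def by blast
      then show "u \<in> indicator_vec A ` closed_sets G A"
        using iff u by blast
    qed
  qed
  moreover have "inj_on (indicator_vec A) (closed_sets G A)"
    using bij by (auto simp: bij_betw_def closed_sets_def intro: inj_on_subset)
  ultimately have "card (closed_sets G A) = card ?K"
    using card_image by metis
  then show ?thesis
    using card_left_kernel_bit[of "cut_mat G A" "card A" "card (pverts G - A)"]
    by (simp add: cutrk_def cut_mat_def)
qed

section \<open>Full cut-rank and local sets\<close>

text \<open>By the count above, full cut-rank means that there is exactly one closed set, and the
  empty set is always closed.\<close>

lemma full_cutrk_iff_closed_sets:
  assumes A: "A \<subseteq> pverts G"
  shows "full_cutrk G A \<longleftrightarrow> closed_sets G A = {{}}"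
proof
  assume "full_cutrk G A"
  then have "card (closed_sets G A) = 1"
    using card_closed_sets[OF A] by (simp add: full_cutrk_def)
  then obtain X where "closed_sets G A = {X}"
    by (rule card_1_singletonE)
  then show "closed_sets G A = {{}}"
    using empty_in_closed_sets[of G A] by simp
next
  assume "closed_sets G A = {{}}"
  then show "full_cutrk G A"
    using card_closed_sets[OF A] by (simp add: full_cutrk_def)
qed

text \<open>A nonempty closed \<open>D\<close> generates a local set inside \<open>A\<close>.
  Conversely, a generator of a local set inside \<open>A\<close> is closed, and it is nonempty
  because \<open>{}\<close> has an empty odd neighborhood.\<close>

lemma full_cutrk_iff_no_local_subset:
  assumes A: "A \<subseteq> pverts G"
  shows "full_cutrk G A \<longleftrightarrow> (\<forall>L\<subseteq>A. \<not> local_set G L)"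
proof
  assume "full_cutrk G A"
  then have closed: "closed_sets G A = {{}}"
    using full_cutrk_iff_closed_sets[OF A] by blast
  have trivial: "D = {}" if "D \<subseteq> A" "odd_nbhd G D \<subseteq> A" for D
  proof -
    have "D \<in> closed_sets G A"
      using that by (simp add: closed_sets_def)
    then show ?thesis
      unfolding closed by simp
  qed
  show "\<forall>L\<subseteq>A. \<not> local_set G L"
  proof (intro allI impI notI)
    fix L assume L: "L \<subseteq> A" "local_set G L"
    then obtain D where D: "L = D \<union> odd_nbhd G D"
      by (auto simp: local_set_def)
    then have "D = {}"
      using trivial L(1) by blast
    then show False
      using D L(2) by (simp add: local_set_def)
  qed
next
  assume none: "\<forall>L\<subseteq>A. \<not> local_set G L"
  have "D = {}" if "D \<in> closed_sets G A" for D
  proof (rule ccontr)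
    assume "D \<noteq> {}"
    then have "local_set G (D \<union> odd_nbhd G D)"
      using that A unfolding local_set_def closed_sets_def by blast
    then show False
      using none that unfolding closed_sets_def by blast
  qed
  then show "full_cutrk G A"
    using full_cutrk_iff_closed_sets[OF A] empty_in_closed_sets[of G A] by blast
qed

text \<open>Adding \<open>a\<close> to \<open>A - {a}\<close> only doubles the product in
  \<open>card_closed_sets\<close>. A larger rank would already use up this factor 2, leaving no room
  for the strictly larger number of closed sets.\<close>

lemma local_set_cutrk_le:
  assumes A: "A \<subseteq> pverts G" and L: "local_set G A" and a: "a \<in> A"
  shows "cutrk G A \<le> cutrk G (A - {a})"
proof (rule ccontr)
  let ?B = "A - {a}"
  let ?k = "card (closed_sets G A)" and ?l = "card (closed_sets G ?B)"
  assume "\<not> ?thesis"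
  then have r: "cutrk G A \<ge> Suc (cutrk G ?B)"
    by simp
  have finA: "finite A"
    using A pair_finite_verts finite_subset by blast
  obtain D where D: "A = D \<union> odd_nbhd G D"
    using L by (auto simp: local_set_def)
  \<comment> \<open>The vertex \<open>a\<close> lies in \<open>D\<close> or in
    \<open>odd_nbhd G D\<close>, so one of the two is not contained in \<open>?B\<close>.\<close>
  then have "D \<in> closed_sets G A" "D \<notin> closed_sets G ?B"
    using a by (auto simp: closed_sets_def)
  then have "closed_sets G ?B \<subset> closed_sets G A"
    using closed_sets_mono[of ?B A G] by auto
  then have "?l < ?k"
    using finite_closed_sets[OF finA] psubset_card_mono by blast
  then have "?l * 2 ^ Suc (cutrk G ?B) < ?k * 2 ^ Suc (cutrk G ?B)"
    by simp
  also have "\<dots> \<le> ?k * 2 ^ cutrk G A"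
    using r by (intro mult_left_mono power_increasing) auto
  also have "\<dots> = 2 ^ card A"
    by (rule card_closed_sets[OF A])
  also have "\<dots> = 2 * 2 ^ card ?B"
    using card.remove[OF finA a] by simp
  also have "2 ^ card ?B = ?l * 2 ^ cutrk G ?B"
    using card_closed_sets[of ?B] A by (metis Diff_subset subset_trans)
  also have "2 * (?l * 2 ^ cutrk G ?B) = ?l * 2 ^ Suc (cutrk G ?B)"
    by simp
  finally show False
    by simp
qed

end

section \<open>Rank characterizations of minimal local sets\<close>

theorem proposition2:
  fixes G :: "'a pair_pre_digraph" and A :: "'a set"
  assumes "pair_graph G" and "A \<subseteq> pverts G"
  shows "(local_set G A \<longrightarrow> (\<forall>a\<in>A. cutrk G A \<le> cutrk G (A - {a})))
    \<and> (minimal_local_set G A \<longleftrightarrow> \<not> full_cutrk G A \<and> (\<forall>B. B \<subset> A \<longrightarrow> full_cutrk G B))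
    \<and> (minimal_local_set G A \<longleftrightarrow>
         A \<noteq> {} \<and> (\<forall>a\<in>A. cutrk G A \<le> cutrk G (A - {a}) \<and> cutrk G (A - {a}) = card A - 1))"
proof (intro conjI)
  interpret pair_graph G
    by fact
  have finA: "finite A"
    using assms(2) pair_finite_verts finite_subset by blast
  \<comment> \<open>In this form full cut-rank visibly passes to subsets, so for proper subsets of
    \<open>A\<close> it suffices to check the sets \<open>A - {a}\<close>.\<close>
  have full: "full_cutrk G B \<longleftrightarrow> (\<forall>L\<subseteq>B. \<not> local_set G L)" if "B \<subseteq> A" for B
    using full_cutrk_iff_no_local_subset that assms(2) by blast
  show part1: "local_set G A \<longrightarrow> (\<forall>a\<in>A. cutrk G A \<le> cutrk G (A - {a}))"
    using local_set_cutrk_le[OF assms(2)] by blast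
  show min_iff: "minimal_local_set G A \<longleftrightarrow> \<not> full_cutrk G A \<and> (\<forall>B. B \<subset> A \<longrightarrow> full_cutrk G B)"
  proof
    assume min: "minimal_local_set G A"
    then have "\<not> full_cutrk G A"
      using full[of A] by (auto simp: minimal_local_set_def)
    moreover have "full_cutrk G B" if "B \<subset> A" for B
      using min full[of B] that unfolding minimal_local_set_def by blast
    ultimately show "\<not> full_cutrk G A \<and> (\<forall>B. B \<subset> A \<longrightarrow> full_cutrk G B)"
      by blast
  next
    assume *: "\<not> full_cutrk G A \<and> (\<forall>B. B \<subset> A \<longrightarrow> full_cutrk G B)"
    have proper: "\<not> local_set G M" if "M \<subset> A" for M
      using * full[of M] that by auto
    \<comment> \<open>Since \<open>A\<close> is not full it contains a local set, which can only be
      \<open>A\<close> itself.\<close>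
    then have "local_set G A"
      using * full[of A] by (metis order_refl psubsetI)
    then show "minimal_local_set G A"
      unfolding minimal_local_set_def using proper by blast
  qed
  have card_Diff: "card (A - {a}) = card A - 1" if "a \<in> A" for a
    using finA that by simp
  show "minimal_local_set G A \<longleftrightarrow>
      A \<noteq> {} \<and> (\<forall>a\<in>A. cutrk G A \<le> cutrk G (A - {a}) \<and> cutrk G (A - {a}) = card A - 1)"
  proof
    assume min: "minimal_local_set G A"
    then have "local_set G A"
      by (simp add: minimal_local_set_def)
    moreover have "full_cutrk G (A - {a})" if "a \<in> A" for a
      using min min_iff that by blast
    ultimately show "A \<noteq> {} \<and>
        (\<forall>a\<in>A. cutrk G A \<le> cutrk G (A - {a}) \<and> cutrk G (A - {a}) = card A - 1)"
      using part1 card_Diff by (auto simp: local_set_def full_cutrk_def)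
  next
    assume *: "A \<noteq> {} \<and> (\<forall>a\<in>A. cutrk G A \<le> cutrk G (A - {a}) \<and> cutrk G (A - {a}) = card A - 1)"
    then obtain a where a: "a \<in> A"
      by blast
    \<comment> \<open>Positivity makes the truncated difference \<open>card A - 1\<close> strictly
      smaller than \<open>card A\<close>, so the bound on \<open>cutrk G A\<close> excludes full
      cut-rank.\<close>
    have "card A > 0"
      using * finA by (simp add: card_gt_0_iff)
    then have "\<not> full_cutrk G A"
      using * a by (fastforce simp: full_cutrk_def)
    moreover have "full_cutrk G B" if "B \<subset> A" for B
    proof -
      obtain b where b: "b \<in> A" "B \<subseteq> A - {b}"
        using \<open>B \<subset> A\<close> by blast
      then have "full_cutrk G (A - {b})"
        using * card_Diff by (simp add: full_cutrk_def)
      then show ?thesis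
        using full[of "A - {b}"] full[of B] b by (meson Diff_subset subset_trans)
    qed
    ultimately show "minimal_local_set G A"
      using min_iff by blast
  qed
qed

end
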